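(* Let $n_1,n_2>0$, $n_{\min}=\min(n_1,n_2)$, $n_{\max}=\max(n_1,n_2)$, $\hat p_\square=\frac{n_{\max}+n_{\min}}{2n_{\max}}$, $V(p_1,p_2)=\frac{p_1(1-p_1)}{n_1}+\frac{p_2(1-p_2)}{n_2}$, and $$V^*(p)=\max\{V(p_1,p_2):(p_1,p_2)\in[0,1]^2,\ p_1-p_2=p\},\qquad p\in[-1,1].$$ Then $$V^*(p)=\begin{cases}\dfrac{n_{\max}+n_{\min}}{4n_{\max}n_{\min}}-\dfrac{p^2}{n_{\max}+n_{\min}},&|p|\le\hat p_\square,\\[2ex]\dfrac{|p|(1-|p|)}{n_{\min}},&|p|>\hat p_\square,\end{cases}$$ the maximum being attained on the first branch at the pair $\left(\tfrac12+\tfrac{n_1p}{n_1+n_2},\ \tfrac12-\tfrac{n_2p}{n_1+n_2}\right)$, and on the second branch at a pair lying on an edge of the unit square associated with the larger sample size (i.e. a pair whose coordinate $p_i$ with $n_i=n_{\max}$ equals $0$ or $1$). The function $V^*$ is even, concave and continuously differentiable on $[-1,1]$, it is strictly positive on $(-1,1)$, and it vanishes at $p=\pm1$. Moreover, for every $z>0$ and every $\hat p\in[-1,1]$, with $$\Omega_\square=\{(p_1,p_2)\in[0,1]^2:(\hat p-p_1+p_2)^2\le z^2V(p_1,p_2)\},$$ one has $$\Bigl[\min_{(p_1,p_2)\in\Omega_\square}(p_1-p_2),\ \max_{(p_1,p_2)\in\Omega_\square}(p_1-p_2)\Bigr]=\bigl\{p\in[-1,1]:(\hat p-p)^2\le 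z^2V^*(p)\bigr\}.$$
   Context: The interval on the left of the last display is called the elliptically optimal (EO) confidence interval for the difference of two proportions; $\hat p$ is the observed difference of sample proportions, $n_1,n_2$ the sample sizes. *)

theory Defs
  imports "HOL-Analysis.Analysis"
begin

definition pdiff :: "real \<times> real \<Rightarrow> real" where
  "pdiff = (\<lambda>(p1, p2). p1 - p2)"

definition V :: "real \<Rightarrow> real \<Rightarrow> real \<times> real \<Rightarrow> real" where
  "V n1 n2 = (\<lambda>(p1, p2). p1 * (1 - p1) / n1 + p2 * (1 - p2) / n2)"

definition slice :: "real \<Rightarrow> (real \<times> real) set" where
  "slice p = {q \<in> {0..1} \<times> {0..1}. pdiff q = p}"

(* GREATEST denotes the maximum of a set that has one and is unspecified otherwise.
   For p outside [-1,1] the slice is empty, so Vstar is meaningful only on [-1,1]. *)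
definition Vstar :: "real \<Rightarrow> real \<Rightarrow> real \<Rightarrow> real" where
  "Vstar n1 n2 p = (GREATEST v. v \<in> V n1 n2 ` slice p)"

definition p_box :: "real \<Rightarrow> real \<Rightarrow> real" where
  "p_box n1 n2 = (max n1 n2 + min n1 n2) / (2 * max n1 n2)"

definition Omega_box :: "real \<Rightarrow> real \<Rightarrow> real \<Rightarrow> real \<Rightarrow> (real \<times> real) set" where
  "Omega_box n1 n2 z phat =
     {(p1, p2) \<in> {0..1} \<times> {0..1}. (phat - p1 + p2)\<^sup>2 \<le> z\<^sup>2 * V n1 n2 (p1, p2)}"

definition EO_interval :: "real \<Rightarrow> real \<Rightarrow> real \<Rightarrow> real \<Rightarrow> real set" where
  "EO_interval n1 n2 z phat =
     {(LEAST d. d \<in> pdiff ` Omega_box n1 n2 z phat) ..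
      (GREATEST d. d \<in> pdiff ` Omega_box n1 n2 z phat)}"

(* One-sided derivatives at the endpoints of the set. The library's C1_differentiable_on
   asks for two-sided derivatives, which would involve values outside the set. *)
definition cont_diff_on :: "real set \<Rightarrow> (real \<Rightarrow> real) \<Rightarrow> bool" where
  "cont_diff_on S f \<longleftrightarrow>
     (\<exists>f'. (\<forall>x\<in>S. (f has_real_derivative f' x) (at x within S)) \<and> continuous_on S f')"

end

theory Submission
  imports Defs
begin

text \<open>
  On a slice \<open>p1 - p2 = p\<close> the function \<open>V n1 n2\<close> depends on \<open>p1\<close> alone, and it is a downward
  parabola: completing the square (\<open>V_complete_square\<close>) gives its vertex
  \<open>c = 1/2 + n1 p / (n1 + n2)\<close> and its vertex value
  \<open>(n1 + n2) / (4 n1 n2) - p\<^sup>2 / (n1 + n2)\<close>. A maximiser over the slice is therefore a point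
  whose first coordinate is as near to \<open>c\<close> as the square allows (\<open>nearest_is_arg_max\<close>). The
  vertex itself lies in the square exactly when \<open>\<bar>p\<bar> \<le> p_box n1 n2\<close>; otherwise the line leaves
  the square, on its way to the vertex, through an edge on which the coordinate with the larger
  sample size is \<open>0\<close> or \<open>1\<close>, and that exit point is the maximiser.

  The distance from the exit point to the vertex is proportional to \<open>\<bar>p\<bar> - p_box n1 n2\<close>, so both
  branches are one formula: the parabola in \<open>p\<close>, minus a multiple of the square of the positive part
  of \<open>\<bar>p\<bar> - p_box n1 n2\<close> (\<open>Vstar_penalised\<close>). The square of a positive part is continuously
  differentiable, hence so is \<open>Vstar\<close> across the branch points. Concavity is inherited from that of
  \<open>V\<close>: a convex combination of maximisers on two slices lies on the intermediate slice.

  For the confidence interval, a difference \<open>p\<close> occurs in \<open>Omega_box\<close> exactly when the pair with the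
  largest variance on its slice satisfies the defining inequality, so
  \<open>{p \<in> {-1..1}. (phat - p)\<^sup>2 \<le> z\<^sup>2 * Vstar n1 n2 p}\<close> is the image of \<open>Omega_box\<close> under \<open>pdiff\<close>
  (\<open>pdiff_image_Omega_box\<close>). Since \<open>Omega_box\<close> is compact and nonempty, and convex because \<open>V\<close>
  is concave, that image is a compact interval whose end points are the extreme values of \<open>pdiff\<close>.
\<close>

section \<open>Maximising the variance on a slice\<close>

lemma in_slice_iff:
  "(a, b) \<in> slice p \<longleftrightarrow> 0 \<le> a \<and> a \<le> 1 \<and> 0 \<le> b \<and> b \<le> 1 \<and> b = a - p"
  by (auto simp: slice_def pdiff_def)

lemma midpoint_in_slice:
  assumes "p \<in> {-1..1}"
  shows "((1 + p) / 2, (1 - p) / 2) \<in> slice p"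
  using assms by (auto simp: in_slice_iff field_simps)

lemma V_complete_square:
  fixes n1 n2 :: real
  assumes "n1 > 0" "n2 > 0"
  shows "V n1 n2 (a, a - p) = (n1 + n2) / (4 * n1 * n2) - p\<^sup>2 / (n1 + n2)
           - (n1 + n2) / (n1 * n2) * (a - (1/2 + n1 * p / (n1 + n2)))\<^sup>2"
proof -
  \<comment> \<open>Scaling \<open>p\<close> by \<open>n1 + n2\<close> leaves only the denominators \<open>n1\<close> and \<open>n2\<close>.\<close>
  define d where "d = p / (n1 + n2)"
  have p: "p = d * (n1 + n2)" using assms by (simp add: d_def)
  have "p\<^sup>2 / (n1 + n2) = d\<^sup>2 * (n1 + n2)" "n1 * p / (n1 + n2) = n1 * d"
    using assms by (simp_all add: p power2_eq_square)
  moreover have "V n1 n2 (a, a - p) = (n1 + n2) / (4 * n1 * n2) - d\<^sup>2 * (n1 + n2)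
           - (n1 + n2) / (n1 * n2) * (a - (1/2 + n1 * d))\<^sup>2"
    unfolding V_def p using assms by (simp add: divide_simps) algebra
  ultimately show ?thesis by simp
qed

lemma vertex_displacements:
  fixes n1 n2 :: real
  assumes "n1 > 0" "n2 > 0"
  shows "n1 * p / (n1 + n2) + n2 * p / (n1 + n2) = p"
  using assms by (simp flip: add_divide_distrib distrib_right)

lemma nearest_is_arg_max:
  fixes n1 n2 :: real
  assumes n: "n1 > 0" "n2 > 0" and q: "(a, b) \<in> slice p"
    and near: "\<And>x y. (x, y) \<in> slice p \<Longrightarrow>
      \<bar>a - (1/2 + n1 * p / (n1 + n2))\<bar> \<le> \<bar>x - (1/2 + n1 * p / (n1 + n2))\<bar>"
  shows "is_arg_max (V n1 n2) (\<lambda>q. q \<in> slice p) (a, b)"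
proof -
  have "V n1 n2 (x, y) \<le> V n1 n2 (a, b)" if xy: "(x, y) \<in> slice p" for x y
  proof -
    have "(a - (1/2 + n1 * p / (n1 + n2)))\<^sup>2 \<le> (x - (1/2 + n1 * p / (n1 + n2)))\<^sup>2"
      using near[OF xy] by (simp add: abs_le_square_iff)
    then have "(n1 + n2) / (n1 * n2) * (a - (1/2 + n1 * p / (n1 + n2)))\<^sup>2
               \<le> (n1 + n2) / (n1 * n2) * (x - (1/2 + n1 * p / (n1 + n2)))\<^sup>2"
      by (rule mult_left_mono) (use n in auto)
    moreover have "y = x - p" "b = a - p" using xy q by (auto simp: in_slice_iff)
    ultimately show ?thesis by (simp add: V_complete_square[OF n])
  qed
  with q show ?thesis by (auto simp: is_arg_max_linorder)
qed

lemma Vstar_eq_at_arg_max: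
  assumes "is_arg_max (V n1 n2) (\<lambda>q. q \<in> slice p) q"
  shows "Vstar n1 n2 p = V n1 n2 q"
  unfolding Vstar_def
  by (rule Greatest_equality) (use assms in \<open>auto simp: is_arg_max_linorder\<close>)

lemma p_box_pos:
  assumes "n1 > 0" "n2 > 0"
  shows "p_box n1 n2 > 0"
  unfolding p_box_def using assms by (intro divide_pos_pos) (auto simp: max_def min_def)

lemma le_p_box_iff:
  fixes n1 n2 :: real
  assumes "n1 > 0" "n2 > 0"
  shows "x \<le> p_box n1 n2 \<longleftrightarrow> max n1 n2 * x / (n1 + n2) \<le> 1/2"
  using assms by (auto simp: p_box_def max_def min_def field_simps)

text \<open>
  The vertex of the parabola has first coordinate \<open>1/2 + n1 p / (n1 + n2)\<close> and second coordinate
  \<open>1/2 - n2 p / (n1 + n2)\<close>; of the two displacements from \<open>1/2\<close>, the one with the larger sample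
  size decides whether the vertex lies in the square.
\<close>
lemma vertex_is_arg_max:
  fixes n1 n2 :: real
  assumes n: "n1 > 0" "n2 > 0" and p: "\<bar>p\<bar> \<le> p_box n1 n2"
  shows "is_arg_max (V n1 n2) (\<lambda>q. q \<in> slice p)
           (1/2 + n1 * p / (n1 + n2), 1/2 - n2 * p / (n1 + n2))"
proof (rule nearest_is_arg_max[OF n])
  have m: "max n1 n2 * \<bar>p\<bar> / (n1 + n2) \<le> 1/2"
    using p le_p_box_iff[OF n] by blast
  have "\<bar>k * p / (n1 + n2)\<bar> \<le> 1/2" if "0 < k" "k \<le> max n1 n2" for k
  proof -
    have "\<bar>k * p / (n1 + n2)\<bar> = k * \<bar>p\<bar> / (n1 + n2)"
      using n that by (simp add: abs_mult)
    also have "\<dots> \<le> max n1 n2 * \<bar>p\<bar> / (n1 + n2)"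
      using n that by (intro divide_right_mono mult_right_mono) auto
    finally show ?thesis using m by linarith
  qed
  from this[of n1] this[of n2] n
  have "\<bar>n1 * p / (n1 + n2)\<bar> \<le> 1/2" "\<bar>n2 * p / (n1 + n2)\<bar> \<le> 1/2" by auto
  moreover have "n1 * p / (n1 + n2) + n2 * p / (n1 + n2) = p"
    by (rule vertex_displacements[OF n])
  ultimately show "(1/2 + n1 * p / (n1 + n2), 1/2 - n2 * p / (n1 + n2)) \<in> slice p"
    unfolding in_slice_iff by linarith
qed simp

text \<open>
  Beyond \<open>p_box n1 n2\<close> the vertex lies outside the square, and the point of the slice nearest to it
  is an end point of the slice. Which of the four edges carries that end point depends on the sign
  of \<open>p\<close> and on which sample is the larger one.
\<close>
lemma edge_is_arg_max:
  fixes n1 n2 :: real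
  assumes n: "n1 > 0" "n2 > 0" and p: "p \<in> {-1..1}" "p_box n1 n2 < \<bar>p\<bar>"
  shows "\<exists>a b. is_arg_max (V n1 n2) (\<lambda>q. q \<in> slice p) (a, b)
           \<and> (n1 = max n1 n2 \<longrightarrow> a \<in> {0, 1}) \<and> (n2 = max n1 n2 \<longrightarrow> b \<in> {0, 1})
           \<and> V n1 n2 (a, b) = \<bar>p\<bar> * (1 - \<bar>p\<bar>) / min n1 n2"
proof -
  have m: "max n1 n2 * \<bar>p\<bar> / (n1 + n2) > 1/2"
    using p(2) le_p_box_iff[OF n] by (meson not_le)
  have sum: "n1 * p / (n1 + n2) + n2 * p / (n1 + n2) = p"
    by (rule vertex_displacements[OF n])
  define c where "c = 1/2 + n1 * p / (n1 + n2)"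
  note nearest = nearest_is_arg_max[OF n, where p = p, folded c_def]
  have ne: "n1 \<noteq> n2"
  proof
    assume "n1 = n2"
    then have "p_box n1 n2 = 1" using n by (simp add: p_box_def)
    with p show False by auto
  qed
  then consider "n2 < n1" "p > 0" | "n2 < n1" "p \<le> 0" | "n1 < n2" "p > 0" | "n1 < n2" "p \<le> 0"
    by linarith
  then show ?thesis
  proof cases
    case 1
    then have "n1 * p / (n1 + n2) > 1/2" using m by (simp only: max_absorb1 less_imp_le abs_of_pos)
    then have "c > 1" unfolding c_def by linarith
    then have "is_arg_max (V n1 n2) (\<lambda>q. q \<in> slice p) (1, 1 - p)"
      using 1 p by (intro nearest) (auto simp: in_slice_iff)
    with 1 show ?thesis by (intro exI[of _ 1] exI[of _ "1 - p"]) (auto simp: V_def)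
  next
    case 2
    then have "- (n1 * p / (n1 + n2)) > 1/2" using m by simp
    then have "c < 0" unfolding c_def by linarith
    then have "is_arg_max (V n1 n2) (\<lambda>q. q \<in> slice p) (0, - p)"
      using 2 p by (intro nearest) (auto simp: in_slice_iff)
    with 2 show ?thesis by (intro exI[of _ 0] exI[of _ "- p"]) (auto simp: V_def)
  next
    case 3
    then have "n2 * p / (n1 + n2) > 1/2" using m by simp
    then have "c < p" using sum unfolding c_def by linarith
    then have "is_arg_max (V n1 n2) (\<lambda>q. q \<in> slice p) (p, 0)"
      using 3 p by (intro nearest) (auto simp: in_slice_iff)
    with 3 show ?thesis by (intro exI[of _ p] exI[of _ 0]) (auto simp: V_def)
  next
    case 4
    then have "- (n2 * p / (n1 + n2)) > 1/2" using m by simp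
    then have "c > 1 + p" using sum unfolding c_def by linarith
    then have "is_arg_max (V n1 n2) (\<lambda>q. q \<in> slice p) (1 + p, 1)"
      using 4 p by (intro nearest) (auto simp: in_slice_iff)
    with 4 show ?thesis
      by (intro exI[of _ "1 + p"] exI[of _ 1]) (auto simp: V_def algebra_simps)
  qed
qed

lemma V_arg_max_exists:
  fixes n1 n2 :: real
  assumes "n1 > 0" "n2 > 0" "p \<in> {-1..1}"
  shows "\<exists>q. is_arg_max (V n1 n2) (\<lambda>q. q \<in> slice p) q"
  using vertex_is_arg_max[of n1 n2 p] edge_is_arg_max[of n1 n2 p] assms
  by (meson not_le)

lemma Vstar_attained:
  fixes n1 n2 :: real
  assumes "n1 > 0" "n2 > 0" "p \<in> {-1..1}"
  obtains q where "q \<in> slice p" "Vstar n1 n2 p = V n1 n2 q"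
  using V_arg_max_exists[OF assms] Vstar_eq_at_arg_max
  by (metis (mono_tags, lifting) is_arg_max_def)

lemma V_le_Vstar:
  fixes n1 n2 :: real
  assumes "n1 > 0" "n2 > 0" "p \<in> {-1..1}" "q \<in> slice p"
  shows "V n1 n2 q \<le> Vstar n1 n2 p"
  using V_arg_max_exists[OF assms(1-3)] Vstar_eq_at_arg_max assms(4)
  by (metis (mono_tags, lifting) is_arg_max_linorder)

lemma Vstar_formula:
  fixes n1 n2 :: real
  assumes n: "n1 > 0" "n2 > 0" and p: "p \<in> {-1..1}"
  shows "Vstar n1 n2 p =
        (if \<bar>p\<bar> \<le> p_box n1 n2
         then (max n1 n2 + min n1 n2) / (4 * max n1 n2 * min n1 n2)
                - p\<^sup>2 / (max n1 n2 + min n1 n2)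
         else \<bar>p\<bar> * (1 - \<bar>p\<bar>) / min n1 n2)"
proof (cases "\<bar>p\<bar> \<le> p_box n1 n2")
  case True
  have "n1 * p / (n1 + n2) + n2 * p / (n1 + n2) = p"
    by (rule vertex_displacements[OF n])
  then have "1/2 - n2 * p / (n1 + n2) = (1/2 + n1 * p / (n1 + n2)) - p"
    by linarith
  then have "Vstar n1 n2 p = V n1 n2 (1/2 + n1 * p / (n1 + n2), (1/2 + n1 * p / (n1 + n2)) - p)"
    using Vstar_eq_at_arg_max[OF vertex_is_arg_max[OF n True]] by (simp only:)
  then have "Vstar n1 n2 p = (n1 + n2) / (4 * n1 * n2) - p\<^sup>2 / (n1 + n2)"
    unfolding V_complete_square[OF n] by simp
  with True show ?thesis by (simp add: max_def min_def add.commute mult.commute mult.left_commute)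
next
  case False
  then show ?thesis
    using edge_is_arg_max[OF n p] Vstar_eq_at_arg_max by fastforce
qed

section \<open>Shape of the maximal variance\<close>

text \<open>
  Each of the two sampling variances is a downward parabola in its own proportion: its concavity
  defect is the square \<open>t * (1 - t) * (u - w)\<^sup>2\<close>.
\<close>
lemma concave_V:
  fixes n1 n2 :: real
  assumes n: "n1 > 0" "n2 > 0" and t: "0 \<le> t" "t \<le> 1"
  shows "(1 - t) * V n1 n2 x + t * V n1 n2 y \<le> V n1 n2 ((1 - t) *\<^sub>R x + t *\<^sub>R y)"
proof -
  obtain a b c d where xy: "x = (a, b)" "y = (c, d)" by fastforce
  have variance: "(1 - t) * (u * (1 - u) / k) + t * (w * (1 - w) / k)
      \<le> ((1 - t) * u + t * w) * (1 - ((1 - t) * u + t * w)) / k" if "k > 0" for u w k :: real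
  proof -
    have "((1 - t) * u + t * w) * (1 - ((1 - t) * u + t * w))
          = (1 - t) * (u * (1 - u)) + t * (w * (1 - w)) + t * (1 - t) * (u - w)\<^sup>2"
      by algebra
    moreover have "t * (1 - t) * (u - w)\<^sup>2 \<ge> 0" using t by simp
    ultimately have "(1 - t) * (u * (1 - u)) + t * (w * (1 - w))
          \<le> ((1 - t) * u + t * w) * (1 - ((1 - t) * u + t * w))"
      by linarith
    from divide_right_mono[OF this, of k] that show ?thesis
      by (simp only: add_divide_distrib times_divide_eq_right less_imp_le)
  qed
  show ?thesis
    using add_mono[OF variance[OF n(1), of a c] variance[OF n(2), of b d]]
    by (simp add: xy V_def distrib_left)
qed

lemma slice_convex_combination:
  assumes "x \<in> slice p" "y \<in> slice r" "0 \<le> t" "t \<le> 1"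
  shows "(1 - t) *\<^sub>R x + t *\<^sub>R y \<in> slice ((1 - t) * p + t * r)"
proof -
  have "(1 - t) *\<^sub>R x + t *\<^sub>R y \<in> {0..1} \<times> {0..1}"
    using assms by (intro convexD) (auto simp: slice_def intro: convex_Times)
  moreover have "pdiff ((1 - t) *\<^sub>R x + t *\<^sub>R y) = (1 - t) * pdiff x + t * pdiff y"
    by (simp add: pdiff_def split_beta algebra_simps)
  ultimately show ?thesis using assms by (simp add: slice_def)
qed

lemma concave_on_Vstar:
  fixes n1 n2 :: real
  assumes n: "n1 > 0" "n2 > 0"
  shows "concave_on {-1..1} (Vstar n1 n2)"
  unfolding concave_on_def
proof (rule convex_onI)
  fix t p r :: real
  assume t: "0 < t" "t < 1" and p: "p \<in> {-1..1}" and r: "r \<in> {-1..1}"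
  obtain x where x: "x \<in> slice p" "Vstar n1 n2 p = V n1 n2 x"
    using Vstar_attained[OF n p] .
  obtain y where y: "y \<in> slice r" "Vstar n1 n2 r = V n1 n2 y"
    using Vstar_attained[OF n r] .
  have "(1 - t) * p + t * r \<in> {-1..1}"
    using convexD[of "{-1..1::real}" p r "1 - t" t] p r t by simp
  then have "V n1 n2 ((1 - t) *\<^sub>R x + t *\<^sub>R y) \<le> Vstar n1 n2 ((1 - t) * p + t * r)"
    using slice_convex_combination[OF x(1) y(1)] t by (intro V_le_Vstar[OF n]) auto
  with concave_V[OF n, of t x y] t x y
  show "- Vstar n1 n2 ((1 - t) *\<^sub>R p + t *\<^sub>R r) \<le> (1 - t) * - Vstar n1 n2 p + t * - Vstar n1 n2 r"
    by simp
qed simp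

text \<open>
  Any pair in the open square lying on the slice has positive variance; the midpoint of the slice
  is one.
\<close>
lemma Vstar_pos:
  fixes n1 n2 :: real
  assumes n: "n1 > 0" "n2 > 0" and p: "p \<in> {-1<..<1}"
  shows "Vstar n1 n2 p > 0"
proof -
  have "1 - (1 + p) / 2 = (1 - p) / 2" "1 - (1 - p) / 2 = (1 + p) / 2"
    by (simp_all add: field_simps)
  then have "V n1 n2 ((1 + p) / 2, (1 - p) / 2)
             = (1 + p) / 2 * ((1 - p) / 2) / n1 + (1 - p) / 2 * ((1 + p) / 2) / n2"
    by (simp only: V_def prod.case)
  also have "\<dots> > 0"
  proof -
    have "(1 + p) / 2 > 0" "(1 - p) / 2 > 0" using p by auto
    with n show ?thesis by (metis add_pos_pos divide_pos_pos mult_pos_pos)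
  qed
  finally have "V n1 n2 ((1 + p) / 2, (1 - p) / 2) > 0" .
  also have "\<dots> \<le> Vstar n1 n2 p"
    using p by (intro V_le_Vstar[OF n] midpoint_in_slice) auto
  finally show ?thesis .
qed

lemma Vstar_1:
  fixes n1 n2 :: real
  assumes n: "n1 > 0" "n2 > 0"
  shows "Vstar n1 n2 1 = 0"
proof -
  obtain q where "q \<in> slice 1" "Vstar n1 n2 1 = V n1 n2 q"
    using Vstar_attained[OF n, of 1] by auto
  moreover from this have "q = (1, 0)" by (cases q) (auto simp: in_slice_iff)
  ultimately show ?thesis by (simp add: V_def)
qed

lemma Vstar_even:
  fixes n1 n2 :: real
  assumes "n1 > 0" "n2 > 0" "p \<in> {-1..1}"
  shows "Vstar n1 n2 (- p) = Vstar n1 n2 p"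
  using assms by (simp add: Vstar_formula)

lemma has_real_derivative_pos_part_square:
  "((\<lambda>x. (max 0 x)\<^sup>2) has_real_derivative 2 * max 0 x) (at x)"
proof (cases x "0::real" rule: linorder_cases)
  case less
  then have ev: "\<forall>\<^sub>F y in nhds x. (max 0 y)\<^sup>2 = 0"
    by (intro eventually_nhds_in_open[of "{..<0}", THEN eventually_mono]) auto
  with less show ?thesis by (subst DERIV_cong_ev[OF refl ev refl]) auto
next
  case equal
  have "((\<lambda>h. (max 0 h)\<^sup>2 / h) \<longlongrightarrow> 0) (at (0::real))"
  proof (rule Lim_null_comparison)
    show "\<forall>\<^sub>F h in at (0::real). norm ((max 0 h)\<^sup>2 / h) \<le> \<bar>h\<bar>"
      by (intro always_eventually allI) (auto simp: max_def power2_eq_square)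
  qed (intro tendsto_eq_intros, auto)
  with equal show ?thesis by (simp add: DERIV_def)
next
  case greater
  then have ev: "\<forall>\<^sub>F y in nhds x. (max 0 y)\<^sup>2 = y\<^sup>2"
    by (intro eventually_nhds_in_open[of "{0<..}", THEN eventually_mono]) auto
  have "((\<lambda>y. y\<^sup>2) has_real_derivative 2 * x) (at x)"
    by (auto intro!: derivative_eq_intros)
  with greater ev show ?thesis by (subst DERIV_cong_ev[OF refl ev refl]) auto
qed

text \<open>
  The penalty is the variance lost by stopping at the edge instead of the vertex. By
  \<open>V_complete_square\<close> it is \<open>(n1 + n2) / (n1 * n2)\<close> times the squared distance to the vertex, which is
  \<open>max n1 n2 / (n1 + n2) * (\<bar>p\<bar> - p_box n1 n2)\<close>. Keeping the two signs of \<open>p\<close> in separate terms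
  avoids the absolute value, which is not differentiable.
\<close>
lemma Vstar_penalised:
  fixes n1 n2 :: real
  assumes n: "n1 > 0" "n2 > 0" and p: "p \<in> {-1..1}"
  shows "Vstar n1 n2 p = (n1 + n2) / (4 * n1 * n2) - p\<^sup>2 / (n1 + n2)
           - max n1 n2 / (min n1 n2 * (n1 + n2))
             * ((max 0 (p - p_box n1 n2))\<^sup>2 + (max 0 (- p - p_box n1 n2))\<^sup>2)"
proof -
  define M m where "M = max n1 n2" and "m = min n1 n2"
  have pos: "M > 0" "m > 0" and sum: "n1 + n2 = M + m" and prod: "n1 * n2 = M * m"
    using n by (auto simp: M_def m_def max_def min_def)
  have box: "p_box n1 n2 = (M + m) / (2 * M)" by (simp add: p_box_def M_def m_def)
  have outer: "x * (1 - x) / m = (M + m) / (4 * M * m) - x\<^sup>2 / (M + m)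
          - M / (m * (M + m)) * (x - (M + m) / (2 * M))\<^sup>2" for x
  proof -
    \<comment> \<open>When the larger sample is the first one and \<open>x > 0\<close>, the exit point has first coordinate
      \<open>1\<close>; its variance is \<open>x * (1 - x) / m\<close>, and its offset from the vertex is computed here.\<close>
    have "1 - (1/2 + M * x / (M + m)) = - (M / (M + m) * (x - (M + m) / (2 * M)))"
      using pos by (simp add: right_diff_distrib)
    moreover have "V M m (1, 1 - x) = x * (1 - x) / m" by (simp add: V_def)
    moreover have "(M + m) / (M * m) * (- (M / (M + m) * y))\<^sup>2 = M / (m * (M + m)) * y\<^sup>2" for y
      using pos by (simp add: power_mult_distrib power2_eq_square)
    ultimately show ?thesis
      using V_complete_square[OF pos, of 1 x] by (simp only:)
  qed
  have "Vstar n1 n2 p = (if \<bar>p\<bar> \<le> p_box n1 n2 then (M + m) / (4 * M * m) - p\<^sup>2 / (M + m)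
         else \<bar>p\<bar> * (1 - \<bar>p\<bar>) / m)"
    using Vstar_formula[OF n p] by (simp add: M_def m_def)
  also have "\<dots> = (M + m) / (4 * M * m) - p\<^sup>2 / (M + m)
           - M / (m * (M + m))
             * ((max 0 (p - p_box n1 n2))\<^sup>2 + (max 0 (- p - p_box n1 n2))\<^sup>2)"
  proof (cases "\<bar>p\<bar> \<le> p_box n1 n2")
    case True
    then have "max 0 (p - p_box n1 n2) = 0" "max 0 (- p - p_box n1 n2) = 0" by auto
    with True show ?thesis by simp
  next
    case False
    then have "(max 0 (p - p_box n1 n2))\<^sup>2 + (max 0 (- p - p_box n1 n2))\<^sup>2
               = (\<bar>p\<bar> - p_box n1 n2)\<^sup>2"
      using p_box_pos[OF n] by (cases "p \<ge> 0") (auto simp: max_def)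
    with False outer[of "\<bar>p\<bar>"] show ?thesis by (simp add: box)
  qed
  finally show ?thesis by (simp add: sum prod M_def m_def mult.assoc)
qed

lemma cont_diff_on_Vstar:
  fixes n1 n2 :: real
  assumes n: "n1 > 0" "n2 > 0"
  shows "cont_diff_on {-1..1} (Vstar n1 n2)"
proof -
  define N where "N = n1 + n2"
  have "N > 0" using n by (simp add: N_def)
  define b where "b = p_box n1 n2"
  define K where "K = max n1 n2 / (min n1 n2 * N)"
  define F where "F p = N / (4 * n1 * n2) - p\<^sup>2 / N
     - K * ((max 0 (p - b))\<^sup>2 + (max 0 (- p - b))\<^sup>2)" for p
  define F' where "F' p = - 2 * p / N - K * (2 * max 0 (p - b) - 2 * max 0 (- p - b))" for p
  have "(F has_real_derivative F' p) (at p)" for p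
  proof -
    have "((\<lambda>p. (max 0 (p - b))\<^sup>2) has_real_derivative 2 * max 0 (p - b) * 1) (at p)"
      by (rule DERIV_chain2[OF has_real_derivative_pos_part_square])
        (auto intro!: derivative_eq_intros)
    moreover have "((\<lambda>p. (max 0 (- p - b))\<^sup>2) has_real_derivative 2 * max 0 (- p - b) * (- 1)) (at p)"
      by (rule DERIV_chain2[OF has_real_derivative_pos_part_square])
        (auto intro!: derivative_eq_intros)
    moreover have "((\<lambda>p. N / (4 * n1 * n2) - p\<^sup>2 / N) has_real_derivative - 2 * p / N) (at p)"
      using \<open>N > 0\<close> by (auto intro!: derivative_eq_intros)
    ultimately have "(F has_real_derivative
        - 2 * p / N - K * (2 * max 0 (p - b) * 1 + 2 * max 0 (- p - b) * (- 1))) (at p)"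
      unfolding F_def by (intro DERIV_diff DERIV_cmult DERIV_add)
    then show ?thesis by (simp add: F'_def)
  qed
  then have "(Vstar n1 n2 has_real_derivative F' p) (at p within {-1..1})"
    if "p \<in> {-1..1}" for p
  proof (rule has_field_derivative_transform_within[OF has_field_derivative_at_within zero_less_one that])
    show "F x = Vstar n1 n2 x" if "x \<in> {-1..1}" for x
      using Vstar_penalised[OF n that] by (simp add: F_def N_def K_def b_def)
  qed
  moreover have "continuous_on {-1..1} F'"
    unfolding F'_def using \<open>N > 0\<close> by (auto intro!: continuous_intros)
  ultimately show ?thesis unfolding cont_diff_on_def by blast
qed

section \<open>The confidence interval\<close>

lemma continuous_on_pdiff: "continuous_on S pdiff"
  unfolding pdiff_def split_beta by (intro continuous_intros)

lemma compact_Omega_box: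
  fixes n1 n2 :: real
  assumes n: "n1 > 0" "n2 > 0"
  shows "compact (Omega_box n1 n2 z phat)"
proof -
  have "closed {q :: real \<times> real. (phat - fst q + snd q)\<^sup>2 \<le> z\<^sup>2 * V n1 n2 q}"
    unfolding V_def split_beta using n
    by (intro closed_Collect_le continuous_intros) auto
  then have "compact (({0..1} \<times> {0..1}) \<inter> {q. (phat - fst q + snd q)\<^sup>2 \<le> z\<^sup>2 * V n1 n2 q})"
    by (intro compact_Int_closed compact_Times) auto
  moreover have "({0..1} \<times> {0..1}) \<inter> {q. (phat - fst q + snd q)\<^sup>2 \<le> z\<^sup>2 * V n1 n2 q}
                 = Omega_box n1 n2 z phat"
    by (auto simp: Omega_box_def)
  ultimately show ?thesis by simp
qed

lemma convex_Omega_box: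
  fixes n1 n2 :: real
  assumes n: "n1 > 0" "n2 > 0"
  shows "convex (Omega_box n1 n2 z phat)"
proof (rule convexI)
  fix x y and u t :: real
  assume x: "x \<in> Omega_box n1 n2 z phat" and y: "y \<in> Omega_box n1 n2 z phat"
    and ut: "0 \<le> u" "0 \<le> t" "u + t = 1"
  obtain a b c d where xy: "x = (a, b)" "y = (c, d)" by fastforce
  have u: "u = 1 - t" using ut by simp
  let ?w = "(1 - t) *\<^sub>R x + t *\<^sub>R y"
  define e f where "e = phat - a + b" and "f = phat - c + d"
  have square: "?w \<in> {0..1} \<times> {0..1}"
    using x y ut u by (intro convexD) (auto simp: Omega_box_def intro: convex_Times)
  have "phat - fst ?w + snd ?w = (1 - t) * e + t * f"
    by (simp add: xy e_def f_def algebra_simps)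
  moreover have "((1 - t) * e + t * f)\<^sup>2 = (1 - t) * e\<^sup>2 + t * f\<^sup>2 - t * (1 - t) * (e - f)\<^sup>2"
    by algebra
  moreover have "t * (1 - t) * (e - f)\<^sup>2 \<ge> 0" using ut u by simp
  ultimately have "(phat - fst ?w + snd ?w)\<^sup>2 \<le> (1 - t) * e\<^sup>2 + t * f\<^sup>2" by simp
  also have "\<dots> \<le> (1 - t) * (z\<^sup>2 * V n1 n2 x) + t * (z\<^sup>2 * V n1 n2 y)"
    using x y ut u by (intro add_mono mult_left_mono) (auto simp: Omega_box_def xy e_def f_def)
  also have "\<dots> = z\<^sup>2 * ((1 - t) * V n1 n2 x + t * V n1 n2 y)" by (simp add: algebra_simps)
  also have "\<dots> \<le> z\<^sup>2 * V n1 n2 ?w"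
    using ut u by (intro mult_left_mono concave_V[OF n]) auto
  finally show "u *\<^sub>R x + t *\<^sub>R y \<in> Omega_box n1 n2 z phat"
    using square unfolding u Omega_box_def by (cases ?w) auto
qed

lemma pdiff_image_Omega_box:
  fixes n1 n2 :: real
  assumes n: "n1 > 0" "n2 > 0"
  shows "pdiff ` Omega_box n1 n2 z phat = {p \<in> {-1..1}. (phat - p)\<^sup>2 \<le> z\<^sup>2 * Vstar n1 n2 p}"
    (is "_ = ?J")
proof (intro equalityI subsetI)
  fix p assume "p \<in> pdiff ` Omega_box n1 n2 z phat"
  then obtain a b where ab: "p = a - b" "a \<in> {0..1}" "b \<in> {0..1}"
    and "(phat - a + b)\<^sup>2 \<le> z\<^sup>2 * V n1 n2 (a, b)"
    by (auto simp: pdiff_def Omega_box_def)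
  moreover have "phat - a + b = phat - p" by (simp add: ab)
  ultimately have le: "(phat - p)\<^sup>2 \<le> z\<^sup>2 * V n1 n2 (a, b)" by metis
  from ab have p: "p \<in> {-1..1}" and "(a, b) \<in> slice p" by (auto simp: in_slice_iff)
  then have "z\<^sup>2 * V n1 n2 (a, b) \<le> z\<^sup>2 * Vstar n1 n2 p"
    by (intro mult_left_mono V_le_Vstar[OF n]) auto
  with le p show "p \<in> ?J" by simp
next
  fix p assume p: "p \<in> ?J"
  then obtain q where q: "q \<in> slice p" "Vstar n1 n2 p = V n1 n2 q"
    using Vstar_attained[OF n, of p] by blast
  obtain a b where "q = (a, b)" by fastforce
  with q(1) have ab: "a \<in> {0..1}" "b \<in> {0..1}" "b = a - p" by (auto simp: in_slice_iff)
  then have "phat - a + b = phat - p" by simp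
  with p q(2) \<open>q = (a, b)\<close> have "(phat - a + b)\<^sup>2 \<le> z\<^sup>2 * V n1 n2 (a, b)"
    by (metis (mono_tags, lifting) mem_Collect_eq)
  with ab \<open>q = (a, b)\<close> have "q \<in> Omega_box n1 n2 z phat" "pdiff q = p"
    unfolding Omega_box_def pdiff_def by auto
  then show "p \<in> pdiff ` Omega_box n1 n2 z phat" by blast
qed

text \<open>
  At the pair on the slice of \<open>phat\<close> used here the left-hand side of the defining inequality
  vanishes, so \<open>Omega_box\<close> is never empty.
\<close>
lemma Omega_box_nonempty:
  fixes n1 n2 :: real
  assumes n: "n1 > 0" "n2 > 0" and phat: "phat \<in> {-1..1}"
  shows "Omega_box n1 n2 z phat \<noteq> {}"
proof -
  have "phat - (1 + phat) / 2 + (1 - phat) / 2 = 0" by (simp add: field_simps)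
  moreover have "V n1 n2 ((1 + phat) / 2, (1 - phat) / 2) \<ge> 0"
    using n phat by (auto simp: V_def)
  ultimately have "((1 + phat) / 2, (1 - phat) / 2) \<in> Omega_box n1 n2 z phat"
    using phat by (auto simp: Omega_box_def)
  then show ?thesis by blast
qed

lemma EO_interval_eq:
  fixes n1 n2 :: real
  assumes n: "n1 > 0" "n2 > 0" and phat: "phat \<in> {-1..1}"
  shows "\<exists>q. is_arg_min pdiff (\<lambda>q. q \<in> Omega_box n1 n2 z phat) q" (is ?min)
    and "\<exists>q. is_arg_max pdiff (\<lambda>q. q \<in> Omega_box n1 n2 z phat) q" (is ?max)
    and "EO_interval n1 n2 z phat = {p \<in> {-1..1}. (phat - p)\<^sup>2 \<le> z\<^sup>2 * Vstar n1 n2 p}"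
proof -
  let ?O = "Omega_box n1 n2 z phat"
  have "connected (pdiff ` ?O)" "compact (pdiff ` ?O)"
    by (intro connected_continuous_image compact_continuous_image continuous_on_pdiff
        convex_connected convex_Omega_box compact_Omega_box n)+
  then obtain l r where image: "pdiff ` ?O = {l..r}"
    using connected_compact_interval_1 by blast
  with Omega_box_nonempty[OF n phat] have "l \<le> r" by (metis atLeastatMost_empty_iff image_is_empty)
  then have ends: "l \<in> pdiff ` ?O" "r \<in> pdiff ` ?O" by (auto simp: image)
  have bounds: "l \<le> pdiff q" "pdiff q \<le> r" if "q \<in> ?O" for q
    using that image by (metis atLeastAtMost_iff imageI)+
  show ?min ?max
    using ends bounds by (auto simp: is_arg_min_linorder is_arg_max_linorder image_iff)
  have "(LEAST d. d \<in> pdiff ` ?O) = l" "(GREATEST d. d \<in> pdiff ` ?O) = r"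
    using \<open>l \<le> r\<close> unfolding image by (auto intro: Least_equality Greatest_equality)
  then show "EO_interval n1 n2 z phat = {p \<in> {-1..1}. (phat - p)\<^sup>2 \<le> z\<^sup>2 * Vstar n1 n2 p}"
    unfolding EO_interval_def pdiff_image_Omega_box[OF n, symmetric] by (simp only: image)
qed

theorem lemma2:
  fixes n1 n2 :: real
  assumes "n1 > 0" and "n2 > 0"
  shows
    "(\<forall>p\<in>{-1..1}. Vstar n1 n2 p =
        (if \<bar>p\<bar> \<le> p_box n1 n2
         then (max n1 n2 + min n1 n2) / (4 * max n1 n2 * min n1 n2)
                - p\<^sup>2 / (max n1 n2 + min n1 n2)
         else \<bar>p\<bar> * (1 - \<bar>p\<bar>) / min n1 n2))
     \<and> (\<forall>p\<in>{-1..1}. \<bar>p\<bar> \<le> p_box n1 n2 \<longrightarrow>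
          is_arg_max (V n1 n2) (\<lambda>q. q \<in> slice p)
            (1/2 + n1 * p / (n1 + n2), 1/2 - n2 * p / (n1 + n2)))
     \<and> (\<forall>p\<in>{-1..1}. \<bar>p\<bar> > p_box n1 n2 \<longrightarrow>
          (\<exists>p1 p2. is_arg_max (V n1 n2) (\<lambda>q. q \<in> slice p) (p1, p2)
             \<and> (n1 = max n1 n2 \<longrightarrow> p1 \<in> {0, 1})
             \<and> (n2 = max n1 n2 \<longrightarrow> p2 \<in> {0, 1})))
     \<and> (\<forall>p\<in>{-1..1}. Vstar n1 n2 (- p) = Vstar n1 n2 p)
     \<and> concave_on {-1..1} (Vstar n1 n2)
     \<and> cont_diff_on {-1..1} (Vstar n1 n2)
     \<and> (\<forall>p\<in>{-1<..<1}. Vstar n1 n2 p > 0)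
     \<and> Vstar n1 n2 1 = 0 \<and> Vstar n1 n2 (- 1) = 0
     \<and> (\<forall>z>0. \<forall>phat\<in>{-1..1}.
          (\<exists>q. is_arg_min pdiff (\<lambda>q. q \<in> Omega_box n1 n2 z phat) q)
          \<and> (\<exists>q. is_arg_max pdiff (\<lambda>q. q \<in> Omega_box n1 n2 z phat) q)
          \<and> EO_interval n1 n2 z phat
              = {p \<in> {-1..1}. (phat - p)\<^sup>2 \<le> z\<^sup>2 * Vstar n1 n2 p})"
proof -
  note n = assms
  have "\<exists>p1 p2. is_arg_max (V n1 n2) (\<lambda>q. q \<in> slice p) (p1, p2)
             \<and> (n1 = max n1 n2 \<longrightarrow> p1 \<in> {0, 1})
             \<and> (n2 = max n1 n2 \<longrightarrow> p2 \<in> {0, 1})"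
    if "p \<in> {-1..1}" "\<bar>p\<bar> > p_box n1 n2" for p
    using edge_is_arg_max[OF n that] by blast
  moreover have "Vstar n1 n2 (- 1) = 0"
    using Vstar_even[OF n, of 1] Vstar_1[OF n] by simp
  ultimately show ?thesis
    using Vstar_formula[OF n] vertex_is_arg_max[OF n] Vstar_even[OF n] concave_on_Vstar[OF n]
      cont_diff_on_Vstar[OF n] Vstar_pos[OF n] Vstar_1[OF n] EO_interval_eq[OF n]
    by (intro conjI ballI allI impI) blast+
qed

end
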